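(* Let $p\ge 2$ be an integer, and for each positive integer $n$ let $((i,j))$ denote the $n\times n$ matrix whose $ij$ entry is the greatest common divisor $(i,j)$ of $i$ and $j$, $1\le i,j\le n$. Then, as $n\to\infty$, $$\Vert((i,j))\Vert_p=C_p^{1/p}\,n^{1+(1/p)}+O\left(n^{(1/p)-p}E_p(n)\right),$$ where $$C_p:=\frac{2\zeta(p)-\zeta(p+1)}{(p+1)\zeta(p+1)},$$ and $E_p(x)=x^p$ for $p>2$ and $E_2(x)=x^2\log x$.
   Context: For an $n\times n$ matrix $M=(m_{ij})$ and a positive integer $p$, the $\ell_p$ norm is $\Vert M\Vert_p=\left(\sum_{i=1}^n\sum_{j=1}^n|m_{ij}|^p\right)^{1/p}$. $\zeta$ is the Riemann zeta function. The implied constant may depend on $p$. *)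

theory Defs
  imports Complex_Main "HOL-Library.Landau_Symbols" "Jordan_Normal_Form.Matrix"
begin

definition lp_norm :: "nat \<Rightarrow> real mat \<Rightarrow> real" where
  "lp_norm p M =
    (\<Sum>i<dim_row M. \<Sum>j<dim_col M. \<bar>M $$ (i, j)\<bar> ^ p) powr (1 / real p)"

(* Matrix indices start at 0, so row and column numbers are shifted by one. *)
definition gcd_mat :: "nat \<Rightarrow> real mat" where
  "gcd_mat n = mat n n (\<lambda>(i, j). real (gcd (i + 1) (j + 1)))"

(* The Dirichlet series of the Riemann zeta function on the real half-line s > 1,
   where it converges; the value is not meaningful for other s. *)
definition zeta :: "real \<Rightarrow> real" where
  "zeta s = (\<Sum>k. 1 / real (k + 1) powr s)"

definition C_const :: "nat \<Rightarrow> real" where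
  "C_const p =
    (2 * zeta (real p) - zeta (real p + 1)) / ((real p + 1) * zeta (real p + 1))"

(* Meant for p \<ge> 2 only. *)
definition E_fun :: "nat \<Rightarrow> real \<Rightarrow> real" where
  "E_fun p x = (if p = 2 then x ^ 2 * ln x else x ^ p)"

end

theory Submission
  imports Defs "HOL-Analysis.Infinite_Sum" "HOL-Analysis.Summation_Tests" "HOL-Number_Theory.Totient"
begin

text \<open>
  Write \<open>T n\<close> for the sum of \<open>gcd i j ^ p\<close> over \<open>1 \<le> i, j \<le> n\<close>, and \<open>S\<close> for the power sums
  \<open>S N = 1 ^ p + \<dots> + N ^ p\<close>. A pair \<open>i \<le> k\<close> with \<open>k\<close> fixed is classified by \<open>m = k div gcd i k\<close>,
  and each divisor \<open>m\<close> of \<open>k\<close> arises from \<open>totient m\<close> values of \<open>i\<close>. Since the double sum is twice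
  the sum over the triangle \<open>i \<le> k\<close> minus the diagonal, this gives the exact formula
  \<open>T n = 2 * (\<Sum>m\<le>n. totient m * S (n div m)) - S n\<close> (\<open>sum_gcd_power_eq\<close>).

  Here \<open>S (n div m)\<close> is \<open>(n / m) ^ (p + 1) / (p + 1)\<close> up to \<open>(n / m) ^ p\<close>. The main terms add up to
  \<open>n ^ (p + 1) / (p + 1)\<close> times a partial sum of the series of \<open>totient m / m ^ (p + 1)\<close>. The value of
  that series is \<open>zeta p / zeta (p + 1)\<close>, because \<open>\<Sum>m | m dvd n. totient m = n\<close> says that its product
  with \<open>zeta (p + 1)\<close> is \<open>zeta p\<close> (\<open>totient_series_has_sum\<close>), and this is where \<open>C_const p\<close> comes
  from. The tail of the series is at most \<open>1 / n\<close>, which costs \<open>O(n ^ p)\<close>, and the errors of the power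
  sums cost \<open>n ^ p\<close> times the sum of \<open>1 / m ^ (p - 1)\<close> over \<open>m \<le> n\<close>. That sum is harmonic for
  \<open>p = 2\<close>, the only source of the logarithm, and bounded for \<open>p > 2\<close>. So
  \<open>T n = C_const p * n ^ (p + 1) + O(E_fun p n)\<close> (\<open>sum_gcd_power_error\<close>).

  With \<open>r = 1 / p\<close>, passing from \<open>T n\<close> and its main term \<open>M\<close> to their \<open>r\<close>-th powers multiplies the
  error by at most \<open>M powr (r - 1)\<close> (\<open>abs_powr_diff_le\<close>), which has order
  \<open>n powr ((p + 1) * (r - 1)) = n powr (r - p)\<close>. This is the factor in front of \<open>E_fun\<close>.
\<close>

section \<open>Power sums\<close>

text \<open>
  The factor next to \<open>b - a\<close> in the factorization of \<open>b ^ Suc p - a ^ Suc p\<close> has \<open>Suc p\<close> terms, each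
  between \<open>a ^ p\<close> and \<open>b ^ p\<close>. For \<open>b = a + 1\<close> the bounds serve to compare a power sum with an
  integral by induction.
\<close>

lemma power_Suc_diff_bounds:
  fixes a b :: real
  assumes "0 \<le> a" "a \<le> b"
  shows "real (Suc p) * a ^ p * (b - a) \<le> b ^ Suc p - a ^ Suc p"
    and "b ^ Suc p - a ^ Suc p \<le> real (Suc p) * b ^ p * (b - a)"
proof -
  have eq: "b ^ Suc p - a ^ Suc p = (b - a) * (\<Sum>i<Suc p. a ^ (p - i) * b ^ i)"
    by (subst power_diff_sumr2) simp
  have lo: "a ^ p \<le> a ^ (p - i) * b ^ i" and hi: "a ^ (p - i) * b ^ i \<le> b ^ p" if "i < Suc p" for i
  proof -
    have split: "x ^ p = x ^ (p - i) * x ^ i" for x :: real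
      using that by (simp flip: power_add)
    show "a ^ p \<le> a ^ (p - i) * b ^ i"
      unfolding split[of a] using assms by (intro mult_left_mono power_mono) auto
    show "a ^ (p - i) * b ^ i \<le> b ^ p"
      unfolding split[of b] using assms by (intro mult_right_mono power_mono) auto
  qed
  have "(\<Sum>i<Suc p. a ^ (p - i) * b ^ i) \<ge> (\<Sum>i<Suc p. a ^ p)"
    using lo by (intro sum_mono) auto
  then show "real (Suc p) * a ^ p * (b - a) \<le> b ^ Suc p - a ^ Suc p"
    unfolding eq using assms mult_left_mono[of _ _ "b - a"] by (fastforce simp: mult.commute)
  have "(\<Sum>i<Suc p. a ^ (p - i) * b ^ i) \<le> (\<Sum>i<Suc p. b ^ p)"
    using hi by (intro sum_mono) auto
  then show "b ^ Suc p - a ^ Suc p \<le> real (Suc p) * b ^ p * (b - a)"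
    unfolding eq using assms mult_left_mono[of _ _ "b - a"] by (fastforce simp: mult.commute)
qed

lemma power_sum_bounds_nat:
  shows "real n ^ Suc p / real (Suc p) \<le> (\<Sum>d\<in>{1..n}. real d ^ p)"
    and "p > 0 \<Longrightarrow> (\<Sum>d\<in>{1..n}. real d ^ p) \<le> real n ^ Suc p / real (Suc p) + real n ^ p"
proof (induction n)
  case (Suc n)
  note b = power_Suc_diff_bounds[of "real n" "real (Suc n)" p]
  { case 1
    have "real (Suc n) ^ Suc p / real (Suc p) \<le> real n ^ Suc p / real (Suc p) + real (Suc n) ^ p"
      using b(2) by (simp add: divide_simps) (simp add: algebra_simps)
    then show ?case using Suc.IH(1) by simp
  next
    case 2
    have "real n ^ Suc p / real (Suc p) + real n ^ p \<le> real (Suc n) ^ Suc p / real (Suc p)"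
      using b(1) by (simp add: divide_simps) (simp add: algebra_simps)
    then show ?case using Suc.IH(2) 2 by simp }
qed auto

text \<open>
  Since \<open>n / m\<close> exceeds \<open>n div m\<close> by less than 1, rounding changes \<open>(n / m) ^ Suc p / Suc p\<close> by at
  most \<open>(n / m) ^ p\<close>. The upper and the lower estimate lose one such term each, and on
  opposite sides, so the loss does not double.
\<close>

lemma power_sum_div_approx:
  assumes "p > 0" "m > 0"
  shows "\<bar>(\<Sum>d\<in>{1..n div m}. real d ^ p) - (real n / real m) ^ Suc p / real (Suc p)\<bar>
           \<le> (real n / real m) ^ p"
proof -
  define N x where "N = n div m" and "x = real n / real m"
  have N: "real N \<le> x"
    unfolding N_def x_def by (rule of_nat_div_le_of_nat)
  have "real n < real m * (real N + 1)"
  proof -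
    have "n < m * (N + 1)"
      using assms by (simp add: N_def dividend_less_times_div)
    then show ?thesis by (metis of_nat_less_iff of_nat_mult of_nat_add of_nat_1)
  qed
  then have x: "x < real N + 1" "x \<ge> 0"
    using assms by (auto simp: x_def divide_simps mult.commute)
  have "x ^ Suc p - real N ^ Suc p \<le> real (Suc p) * x ^ p * (x - real N)"
    by (rule power_Suc_diff_bounds) (use N in auto)
  also have "\<dots> \<le> real (Suc p) * x ^ p * 1"
    using x by (intro mult_left_mono) auto
  finally have 1: "x ^ Suc p / real (Suc p) \<le> real N ^ Suc p / real (Suc p) + x ^ p"
    by (simp add: divide_simps) (simp add: algebra_simps)
  have 2: "real N ^ Suc p / real (Suc p) \<le> x ^ Suc p / real (Suc p)" "real N ^ p \<le> x ^ p"
    using N by (auto intro!: divide_right_mono power_mono simp del: power_Suc)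
  show ?thesis
    using 1 2 power_sum_bounds_nat(1)[of N p] power_sum_bounds_nat(2)[of p N] assms(1)
    unfolding N_def[symmetric] x_def[symmetric] by linarith
qed

section \<open>The sum of the powers of the greatest common divisors\<close>

text \<open>
  Both sides run over the pairs \<open>(m, d)\<close> with \<open>m * d \<le> n\<close>; on the left they are grouped by their
  product \<open>k\<close>.
\<close>

lemma sum_divisor_pairs:
  fixes f :: "nat \<Rightarrow> nat \<Rightarrow> 'a::comm_monoid_add"
  shows "(\<Sum>k\<in>{1..n}. \<Sum>m | m dvd k. f m (k div m)) = (\<Sum>m\<in>{1..n}. \<Sum>d\<in>{1..n div m}. f m d)"
proof -
  have le: "m \<le> n" if "m * d \<le> n" "0 < d" for m d
    using that by (cases d) auto
  have "(\<Sum>k\<in>{1..n}. \<Sum>m | m dvd k. f m (k div m))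
          = (\<Sum>(k, m)\<in>(SIGMA k:{1..n}. {m. m dvd k}). f m (k div m))"
    by (subst sum.Sigma) auto
  also have "\<dots> = (\<Sum>(m, d)\<in>(SIGMA m:{1..n}. {1..n div m}). f m d)"
    by (rule sum.reindex_bij_witness[of _ "\<lambda>(m, d). (m * d, m)" "\<lambda>(k, m). (m, k div m)"])
       (auto simp: less_eq_div_iff_mult_less_eq mult.commute Suc_le_eq intro: le
             intro!: Nat.gr0I elim!: dvdE)
  also have "\<dots> = (\<Sum>m\<in>{1..n}. \<Sum>d\<in>{1..n div m}. f m d)"
    by (subst sum.Sigma) auto
  finally show ?thesis .
qed

text \<open>
  Group the \<open>i\<close> by \<open>d = gcd i k\<close>; dividing by \<open>d\<close> turns them into the totatives of \<open>k div d\<close>. Then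
  pass to the complementary divisor \<open>m = k div d\<close>.
\<close>

lemma sum_gcd_eq_sum_totient:
  fixes g :: "nat \<Rightarrow> real"
  assumes "k > 0"
  shows "(\<Sum>i\<in>{1..k}. g (gcd i k)) = (\<Sum>m | m dvd k. real (totient m) * g (k div m))"
proof -
  have "(\<Sum>i\<in>{1..k}. g (gcd i k)) = (\<Sum>d | d dvd k. \<Sum>i | i \<in> {1..k} \<and> gcd i k = d. g (gcd i k))"
    by (rule sum.group[symmetric]) (use assms in auto)
  also have "\<dots> = (\<Sum>d | d dvd k. real (totient (k div d)) * g d)"
  proof (rule sum.cong[OF refl])
    fix d assume "d \<in> {d. d dvd k}"
    then have "card {i. i \<in> {1..k} \<and> gcd i k = d} = totient (k div d)"
      using card_gcd_eq_totient[of k d] assms by (simp add: Suc_le_eq)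
    then show "(\<Sum>i | i \<in> {1..k} \<and> gcd i k = d. g (gcd i k)) = real (totient (k div d)) * g d"
      by simp
  qed
  also have "\<dots> = (\<Sum>m | m dvd k. real (totient m) * g (k div m))"
    by (rule sum.reindex_bij_witness[of _ "(div) k" "(div) k"]) (use assms in \<open>auto elim: dvdE\<close>)
  finally show ?thesis .
qed

lemma sum_square_eq_sum_triangle:
  fixes h :: "nat \<Rightarrow> nat \<Rightarrow> real"
  assumes "\<And>i j. h i j = h j i"
  shows "(\<Sum>i\<in>{1..n}. \<Sum>j\<in>{1..n}. h i j) = 2 * (\<Sum>k\<in>{1..n}. \<Sum>i\<in>{1..k}. h i k) - (\<Sum>k\<in>{1..n}. h k k)"
proof (induction n)
  case (Suc n)
  have "(\<Sum>j\<in>{1..n}. h (Suc n) j) = (\<Sum>j\<in>{1..n}. h j (Suc n))"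
    by (simp add: assms)
  then show ?case using Suc by (simp add: sum.distrib)
qed simp

lemma sum_gcd_power_eq:
  "(\<Sum>i\<in>{1..n}. \<Sum>j\<in>{1..n}. real (gcd i j) ^ p)
     = 2 * (\<Sum>m\<in>{1..n}. real (totient m) * (\<Sum>d\<in>{1..n div m}. real d ^ p)) - (\<Sum>d\<in>{1..n}. real d ^ p)"
proof -
  have "(\<Sum>k\<in>{1..n}. \<Sum>i\<in>{1..k}. real (gcd i k) ^ p)
          = (\<Sum>k\<in>{1..n}. \<Sum>m | m dvd k. real (totient m) * real (k div m) ^ p)"
    by (intro sum.cong refl sum_gcd_eq_sum_totient[where g = "\<lambda>d. real d ^ p"]) auto
  also have "\<dots> = (\<Sum>m\<in>{1..n}. real (totient m) * (\<Sum>d\<in>{1..n div m}. real d ^ p))"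
    by (subst sum_divisor_pairs) (simp add: sum_distrib_left)
  finally show ?thesis
    by (subst sum_square_eq_sum_triangle) (simp_all add: gcd.commute)
qed

section \<open>The Dirichlet series of the totient function\<close>

text \<open>
  The bound telescopes, since \<open>1 / (m + 1) ^ 2 \<le> 1 / (m * (m + 1)) = 1 / m - 1 / (m + 1)\<close>.
\<close>

lemma sum_inverse_squares_tail:
  assumes "n > 0" "n \<le> N"
  shows "(\<Sum>m\<in>{n<..N}. 1 / real m ^ 2) \<le> 1 / real n - 1 / real N"
  using assms(2)
proof (induction N rule: dec_induct)
  case (step N)
  have "1 / real (Suc N) ^ 2 \<le> 1 / real N - 1 / real (Suc N)"
    using step assms by (simp add: divide_simps power2_eq_square)
  moreover have "{n<..Suc N} = insert (Suc N) {n<..N}"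
    using step by auto
  ultimately show ?case using step.IH by simp
qed simp

lemma sum_inverse_squares_le: "(\<Sum>m\<in>{1..n}. 1 / real m ^ 2) \<le> 2"
proof (cases "n = 0")
  case False
  then have "{1..n} = insert 1 {1<..n}" by auto
  then have "(\<Sum>m\<in>{1..n}. 1 / real m ^ 2) = 1 + (\<Sum>m\<in>{1<..n}. 1 / real m ^ 2)"
    by simp
  also have "\<dots> \<le> 1 + (1 / real 1 - 1 / real n)"
    using False by (intro add_left_mono sum_inverse_squares_tail) auto
  also have "\<dots> \<le> 2" by simp
  finally show ?thesis .
qed simp

text \<open>
  Comparison with inverse squares for every \<open>p\<close> at once is crude for \<open>p > 2\<close>, but the resulting tail
  \<open>1 / n\<close> is all that an error of order \<open>n ^ p\<close> requires.
\<close>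

lemma totient_term_le:
  assumes "p \<ge> 2" "m > 0"
  shows "real (totient m) / real m ^ Suc p \<le> 1 / real m ^ 2"
proof -
  have "real (totient m) / real m ^ Suc p \<le> real m / real m ^ Suc p"
    using totient_le[of m] by (intro divide_right_mono) auto
  also have "\<dots> = 1 / real m ^ p" using assms by simp
  also have "\<dots> \<le> 1 / real m ^ 2"
    using assms by (intro divide_left_mono power_increasing) auto
  finally show ?thesis .
qed

lemma zeta_has_sum:
  assumes "p \<ge> 2"
  shows "((\<lambda>k. 1 / real k ^ p) has_sum zeta (real p)) {1..}"
proof -
  have "summable (\<lambda>k. 1 / real (k + 1) powr real p)"
  proof -
    have "summable (\<lambda>k. inverse (real k ^ p))"
      by (rule inverse_power_summable) (use assms in auto)
    then have "summable (\<lambda>k. inverse (real (Suc k) ^ p))"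
      by (subst summable_Suc_iff)
    then show ?thesis by (simp add: powr_realpow field_simps del: of_nat_Suc)
  qed
  then have "(\<lambda>k. 1 / real (k + 1) powr real p) sums zeta (real p)"
    unfolding zeta_def by (rule summable_sums)
  then have "((\<lambda>k. 1 / real (k + 1) powr real p) has_sum zeta (real p)) UNIV"
    by (rule sums_nonneg_imp_has_sum) auto
  then have "((\<lambda>k. 1 / real k ^ p) \<circ> Suc has_sum zeta (real p)) UNIV"
    by (simp add: o_def powr_realpow del: of_nat_Suc)
  then have "((\<lambda>k. 1 / real k ^ p) has_sum zeta (real p)) (range Suc)"
    by (subst has_sum_reindex) auto
  moreover have "range Suc = {1..}"
    by (auto simp: image_iff Suc_le_eq gr0_conv_Suc)
  ultimately show ?thesis by simp
qed

lemma zeta_pos: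
  assumes "p \<ge> 2"
  shows "zeta (real p) > 0"
proof -
  have "(\<Sum>k\<in>{1}. 1 / real k ^ p) \<le> zeta (real p)"
    by (rule has_sum_mono2[OF has_sum_finite zeta_has_sum[OF assms]]) auto
  then show ?thesis by simp
qed

text \<open>
  This is the Dirichlet product identity behind \<open>\<Sum>m | m dvd n. totient m = n\<close>. All terms are
  nonnegative, so the double series over \<open>(m, k)\<close> with terms \<open>totient m / (m * k) ^ Suc p\<close> may be
  summed in two ways: as a product, or grouped by \<open>n = m * k\<close>, where the terms with a given \<open>n\<close>
  add up to \<open>n / n ^ Suc p\<close>.
\<close>

lemma totient_series_has_sum:
  assumes "p \<ge> 2"
  shows "((\<lambda>m. real (totient m) / real m ^ Suc p) has_sum (zeta (real p) / zeta (real p + 1))) {1..}"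
proof -
  define f where "f = (\<lambda>m. real (totient m) / real m ^ Suc p)"
  have "f summable_on {1..}"
    by (rule summable_on_comparison_test[OF has_sum_imp_summable[OF zeta_has_sum[of 2]]])
       (use totient_term_le[OF assms] in \<open>auto simp: f_def Suc_le_eq simp del: power_Suc\<close>)
  then obtain A where A: "(f has_sum A) {1..}"
    by (auto simp: summable_on_def)
  have Z: "((\<lambda>k. 1 / real k ^ Suc p) has_sum zeta (real p + 1)) {1..}"
    using zeta_has_sum[of "Suc p"] assms by (simp add: add.commute)
  define F where "F = (\<lambda>(m, k). f m * (1 / real k ^ Suc p))"
  have inner: "((\<lambda>k. F (m, k)) has_sum (f m * zeta (real p + 1))) {1..}" for m
    unfolding F_def prod.case by (rule has_sum_cmult_right[OF Z])
  have outer: "((\<lambda>m. f m * zeta (real p + 1)) has_sum (A * zeta (real p + 1))) {1..}"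
    by (rule has_sum_cmult_left[OF A])
  have "(F has_sum (A * zeta (real p + 1))) ({1..} \<times> {1..})"
  proof (rule has_sum_SigmaI)
    show "F summable_on {1..} \<times> {1..}"
      by (rule summable_on_SigmaI) (use inner has_sum_imp_summable[OF outer] in \<open>auto simp: F_def f_def\<close>)
  qed (use inner outer in auto)
  also have "?this \<longleftrightarrow> ((\<lambda>(n, m). real (totient m) / real n ^ Suc p) has_sum (A * zeta (real p + 1)))
                (SIGMA n:{1..}. {m. m dvd n})"
    by (rule has_sum_reindex_bij_witness[of _ "\<lambda>(n, m). (m, n div m)" "\<lambda>(m, k). (m * k, m)"])
       (auto simp: F_def f_def Suc_le_eq dvd_div_eq_0_iff power_mult_distrib intro!: Nat.gr0I elim!: dvdE)
  finally have "((\<lambda>n. \<Sum>m | m dvd n. real (totient m) / real n ^ Suc p) has_sum (A * zeta (real p + 1))) {1..}"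
    by (rule has_sum_SigmaD) auto
  also have "?this \<longleftrightarrow> ((\<lambda>n. 1 / real n ^ p) has_sum (A * zeta (real p + 1))) {1..}"
  proof (rule has_sum_cong)
    fix n :: nat assume "n \<in> {1..}"
    moreover have "(\<Sum>m | m dvd n. real (totient m)) = real n"
      by (simp add: totient_divisor_sum flip: of_nat_sum)
    ultimately show "(\<Sum>m | m dvd n. real (totient m) / real n ^ Suc p) = 1 / real n ^ p"
      by (simp flip: sum_divide_distrib)
  qed
  finally have "A * zeta (real p + 1) = zeta (real p)"
    using zeta_has_sum[OF assms] has_sum_unique by blast
  moreover have "zeta (real p + 1) > 0"
    using zeta_pos[of "Suc p"] assms by (simp add: add.commute)
  ultimately have "A = zeta (real p) / zeta (real p + 1)"
    by (simp add: field_simps)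
  then show ?thesis using A by (simp add: f_def)
qed

lemma totient_series_partial_sum:
  assumes "p \<ge> 2" "n > 0"
  defines "s \<equiv> \<Sum>m\<in>{1..n}. real (totient m) / real m ^ Suc p"
  shows "s \<le> zeta (real p) / zeta (real p + 1)"
    and "zeta (real p) / zeta (real p + 1) \<le> s + 1 / real n"
proof -
  let ?f = "\<lambda>m. real (totient m) / real m ^ Suc p"
  note A = totient_series_has_sum[OF assms(1)]
  show "s \<le> zeta (real p) / zeta (real p + 1)"
    unfolding s_def by (rule has_sum_mono2[OF has_sum_finite A]) auto
  show "zeta (real p) / zeta (real p + 1) \<le> s + 1 / real n"
  proof (rule has_sum_le_finite_sums[OF A])
    fix F :: "nat set" assume F: "finite F" "F \<subseteq> {1..}"
    define N where "N = Max (insert n F)"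
    have N: "n \<le> N" "\<And>m. m \<in> F \<Longrightarrow> m \<le> N"
      using F by (auto simp: N_def)
    have "sum ?f F \<le> sum ?f {1..N}"
      by (rule sum_mono2) (use F N in auto)
    also have "{1..N} = {1..n} \<union> {n<..N}"
      using N assms(2) by auto
    also have "sum ?f \<dots> = s + sum ?f {n<..N}"
      unfolding s_def by (rule sum.union_disjoint) auto
    also have "sum ?f {n<..N} \<le> (\<Sum>m\<in>{n<..N}. 1 / real m ^ 2)"
      by (rule sum_mono, rule totient_term_le) (use assms(1) in auto)
    also have "\<dots> \<le> 1 / real n - 1 / real N"
      using assms(2) N(1) by (rule sum_inverse_squares_tail)
    also have "\<dots> \<le> 1 / real n" by simp
    finally show "sum ?f F \<le> s + 1 / real n" by simp
  qed
qed

section \<open>The asymptotic formula before taking the root\<close>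

text \<open>
  In this form the numerator is visibly positive, the first term of the totient series being 1.
\<close>

lemma C_const_eq:
  assumes "p \<ge> 2"
  shows "C_const p = (2 * (zeta (real p) / zeta (real p + 1)) - 1) / real (Suc p)"
proof -
  have "zeta (real p + 1) > 0"
    using zeta_pos[of "Suc p"] assms by (simp add: add.commute)
  then show ?thesis unfolding C_const_def by (simp add: divide_simps)
qed

lemma C_const_pos:
  assumes "p \<ge> 2"
  shows "C_const p > 0"
  using totient_series_partial_sum(1)[OF assms, of 1] by (simp add: C_const_eq[OF assms])

text \<open>
  Of the three copies of \<open>n ^ p\<close>, one comes from the power sum on the diagonal and two from
  the tail of the totient series. The remaining sum collects the errors of the power sums
  \<open>S (n div m)\<close>, weighted by \<open>totient m \<le> m\<close>.
\<close>

lemma sum_gcd_power_approx: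
  assumes "p \<ge> 2" "n > 0"
  shows "\<bar>(\<Sum>i\<in>{1..n}. \<Sum>j\<in>{1..n}. real (gcd i j) ^ p) - C_const p * real n ^ Suc p\<bar>
           \<le> real n ^ p * (3 + 2 * (\<Sum>m\<in>{1..n}. 1 / real m ^ (p - 1)))"
proof -
  define A where "A = zeta (real p) / zeta (real p + 1)"
  define s where "s = (\<Sum>m\<in>{1..n}. real (totient m) / real m ^ Suc p)"
  define S where "S = (\<lambda>N. \<Sum>d\<in>{1..N::nat}. real d ^ p)"
  define B where "B = real n ^ Suc p / real (Suc p)"
  define W where "W = (\<Sum>m\<in>{1..n}. real (totient m) * S (n div m))"
  have S_n: "\<bar>S n - B\<bar> \<le> real n ^ p"
    using power_sum_div_approx[of p 1 n] assms by (simp add: S_def B_def)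
  have "W - B * s = (\<Sum>m\<in>{1..n}. real (totient m) * (S (n div m) - (real n / real m) ^ Suc p / real (Suc p)))"
    unfolding W_def s_def B_def
    by (simp add: sum_distrib_left sum_subtractf right_diff_distrib power_divide mult_ac del: power_Suc)
  also have "\<bar>\<dots>\<bar> \<le> (\<Sum>m\<in>{1..n}. real n ^ p * (1 / real m ^ (p - 1)))"
  proof (rule order.trans[OF sum_abs], rule sum_mono)
    fix m assume m: "m \<in> {1..n}"
    have "\<bar>real (totient m) * (S (n div m) - (real n / real m) ^ Suc p / real (Suc p))\<bar>
            \<le> real m * (real n / real m) ^ p"
      unfolding abs_mult S_def using totient_le[of m] m assms
      by (intro mult_mono power_sum_div_approx) auto
    also have "\<dots> = real n ^ p * (1 / real m ^ (p - 1))"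
      using m assms by (cases p) (auto simp: power_divide)
    finally show "\<bar>real (totient m) * (S (n div m) - (real n / real m) ^ Suc p / real (Suc p))\<bar>
            \<le> real n ^ p * (1 / real m ^ (p - 1))" .
  qed
  finally have W: "\<bar>W - B * s\<bar> \<le> real n ^ p * (\<Sum>m\<in>{1..n}. 1 / real m ^ (p - 1))"
    by (simp add: sum_distrib_left)
  have "B \<ge> 0" by (simp add: B_def)
  have "0 \<le> A - s" "A - s \<le> 1 / real n"
    using totient_series_partial_sum[OF assms] by (simp_all add: A_def s_def)
  then have "0 \<le> B * (A - s)" "B * (A - s) \<le> B * (1 / real n)"
    using \<open>B \<ge> 0\<close> by (simp_all only: mult_nonneg_nonneg mult_left_mono)
  then have "\<bar>B * (A - s)\<bar> \<le> B * (1 / real n)" by linarith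
  also have "\<dots> \<le> real n ^ p"
    using assms by (simp add: B_def field_simps)
  finally have tail: "\<bar>B * (A - s)\<bar> \<le> real n ^ p" .
  have "(\<Sum>i\<in>{1..n}. \<Sum>j\<in>{1..n}. real (gcd i j) ^ p) - C_const p * real n ^ Suc p
          = 2 * (W - B * s) - (S n - B) - 2 * (B * (A - s))"
    unfolding sum_gcd_power_eq C_const_eq[OF assms(1)]
    by (simp add: W_def S_def A_def B_def algebra_simps diff_divide_distrib del: power_Suc of_nat_Suc)
  then show ?thesis
    using W S_n tail by (simp add: distrib_left del: power_Suc)
qed

lemma sum_inverse_le_ln: "n > 0 \<Longrightarrow> (\<Sum>m\<in>{1..n}. 1 / real m) \<le> 1 + ln (real n)"
proof (induction n rule: nat_induct_non_zero)
  case (Suc n)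
  have "ln (real n / real (Suc n)) \<le> real n / real (Suc n) - 1"
    using Suc by (intro ln_le_minus_one) auto
  also have "\<dots> = - (1 / real (Suc n))" by (simp add: field_simps)
  finally show ?case using Suc by (simp add: ln_div)
qed simp

text \<open>
  The condition \<open>n \<ge> 3\<close> gives \<open>ln n \<ge> 1\<close>, so that for \<open>p = 2\<close> the logarithm absorbs the constants:
  \<open>3 + 2 * (1 + ln n) \<le> 7 * ln n\<close>. For \<open>p > 2\<close> the constant is \<open>3 + 2 * 2\<close>.
\<close>

lemma sum_gcd_power_error:
  assumes "p \<ge> 2" "n \<ge> 3"
  shows "\<bar>(\<Sum>i\<in>{1..n}. \<Sum>j\<in>{1..n}. real (gcd i j) ^ p) - C_const p * real n ^ Suc p\<bar>
           \<le> 7 * E_fun p (real n)"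
proof -
  have "3 + 2 * (\<Sum>m\<in>{1..n}. 1 / real m ^ (p - 1)) \<le> (if p = 2 then 7 * ln (real n) else 7)"
  proof (cases "p = 2")
    case True
    have "exp 1 \<le> real n" using exp_le assms(2) by linarith
    then have "1 \<le> ln (real n)" using assms by (simp add: ln_ge_iff)
    then show ?thesis using sum_inverse_le_ln[of n] True assms by simp
  next
    case False
    then have "(\<Sum>m\<in>{1..n}. 1 / real m ^ (p - 1)) \<le> (\<Sum>m\<in>{1..n}. 1 / real m ^ 2)"
      using assms by (intro sum_mono divide_left_mono power_increasing) auto
    then show ?thesis using sum_inverse_squares_le[of n] False by simp
  qed
  then have "real n ^ p * (3 + 2 * (\<Sum>m\<in>{1..n}. 1 / real m ^ (p - 1)))
               \<le> real n ^ p * (if p = 2 then 7 * ln (real n) else 7)"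
    by (intro mult_left_mono) auto
  also have "\<dots> = 7 * E_fun p (real n)" by (simp add: E_fun_def)
  finally show ?thesis using sum_gcd_power_approx[of p n] assms by simp
qed

section \<open>Taking the root\<close>

text \<open>
  Dividing by \<open>b powr r\<close> reduces this to \<open>\<bar>t powr r - 1\<bar> \<le> \<bar>t - 1\<bar>\<close> for \<open>t = a / b\<close>, which holds because
  \<open>t powr r\<close> lies between 1 and \<open>t\<close>. A bound from the mean value theorem
  would involve the smaller of \<open>a\<close> and \<open>b\<close>; here only \<open>b\<close>, the explicit main term, enters.
\<close>

lemma abs_powr_diff_le:
  fixes a b r :: real
  assumes "a \<ge> 0" "b > 0" "0 < r" "r \<le> 1"
  shows "\<bar>a powr r - b powr r\<bar> \<le> \<bar>a - b\<bar> * b powr (r - 1)"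
proof -
  define t where "t = a / b"
  have t: "t \<ge> 0" "a = t * b" using assms by (auto simp: t_def)
  have "\<bar>t powr r - 1\<bar> \<le> \<bar>t - 1\<bar>"
  proof (cases "t \<ge> 1")
    case True
    then show ?thesis
      using powr_mono[of r 1 t] ge_one_powr_ge_zero[of t r] assms by simp
  next
    case False
    then show ?thesis
      using powr_mono'[of r 1 t] powr_le1[of r t] t assms by simp
  qed
  then have "\<bar>t powr r - 1\<bar> * b powr r \<le> \<bar>t - 1\<bar> * b powr r"
    by (rule mult_right_mono) simp
  moreover have "\<bar>a powr r - b powr r\<bar> = \<bar>t powr r - 1\<bar> * b powr r"
    using t assms by (simp add: powr_mult left_diff_distrib abs_mult_pos)
  moreover have "\<bar>a - b\<bar> * b powr (r - 1) = \<bar>t - 1\<bar> * b powr r"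
  proof -
    have "\<bar>a - b\<bar> = \<bar>t - 1\<bar> * b"
      using t assms by (simp add: left_diff_distrib abs_mult_pos)
    then show ?thesis using assms by (simp add: powr_diff)
  qed
  ultimately show ?thesis by simp
qed

lemma lp_norm_gcd_mat:
  "lp_norm p (gcd_mat n) = (\<Sum>i\<in>{1..n}. \<Sum>j\<in>{1..n}. real (gcd i j) ^ p) powr (1 / real p)"
proof -
  have shift: "(\<Sum>i<n. f (Suc i)) = (\<Sum>i\<in>{1..n}. f i)" for f :: "nat \<Rightarrow> real"
    using sum.atLeast1_atMost_eq[of f n] by simp
  have "(\<Sum>i<n. \<Sum>j<n. \<bar>gcd_mat n $$ (i, j)\<bar> ^ p) = (\<Sum>i<n. \<Sum>j<n. real (gcd (Suc i) (Suc j)) ^ p)"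
    by (intro sum.cong refl) (simp add: gcd_mat_def)
  also have "\<dots> = (\<Sum>i<n. \<Sum>j\<in>{1..n}. real (gcd (Suc i) j) ^ p)"
    using shift[of "\<lambda>j. real (gcd (Suc i) j) ^ p" for i] by simp
  also have "\<dots> = (\<Sum>i\<in>{1..n}. \<Sum>j\<in>{1..n}. real (gcd i j) ^ p)"
    by (rule shift)
  finally show ?thesis
    by (simp add: lp_norm_def gcd_mat_def)
qed

theorem corollary6p1:
  fixes p :: nat
  assumes "p \<ge> 2"
  shows "(\<lambda>n::nat. lp_norm p (gcd_mat n)
            - C_const p powr (1 / real p) * real n powr (1 + 1 / real p))
         \<in> O(\<lambda>n. real n powr (1 / real p - real p) * E_fun p (real n))"
proof (rule bigoI[of _ "7 * C_const p powr (1 / real p - 1)"], rule eventually_sequentiallyI[of 3])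
  fix n :: nat assume n: "n \<ge> 3"
  define T where "T = (\<Sum>i\<in>{1..n}. \<Sum>j\<in>{1..n}. real (gcd i j) ^ p)"
  define M where "M = C_const p * real n ^ Suc p"
  define r where "r = 1 / real p"
  have r: "0 < r" "r \<le> 1" using assms by (auto simp: r_def)
  have C: "C_const p > 0" using assms by (rule C_const_pos)
  have M_pos: "M > 0" using C n by (simp add: M_def)
  have M_powr: "M powr x = C_const p powr x * real n powr ((real p + 1) * x)" for x
  proof -
    have "M = C_const p * real n powr (real p + 1)"
      using n by (simp add: M_def powr_realpow[of "real n" "Suc p", symmetric] add.commute del: power_Suc)
    then show ?thesis using C by (simp add: powr_mult powr_powr)
  qed
  have T_nonneg: "T \<ge> 0" by (auto simp: T_def intro!: sum_nonneg)
  have E: "E_fun p (real n) \<ge> 0" using n by (simp add: E_fun_def)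
  have e1: "(real p + 1) * r = 1 + r" and e2: "(real p + 1) * (r - 1) = r - real p"
    using assms by (simp_all add: r_def field_simps)
  have "\<bar>T powr r - M powr r\<bar> \<le> \<bar>T - M\<bar> * M powr (r - 1)"
    using T_nonneg M_pos r by (rule abs_powr_diff_le)
  also have "\<dots> \<le> 7 * E_fun p (real n) * M powr (r - 1)"
    using sum_gcd_power_error[OF assms n] by (intro mult_right_mono) (simp_all add: T_def M_def)
  also have "\<dots> = 7 * C_const p powr (r - 1) * \<bar>real n powr (r - real p) * E_fun p (real n)\<bar>"
    using E by (simp add: M_powr e2)
  finally show "norm (lp_norm p (gcd_mat n)
            - C_const p powr (1 / real p) * real n powr (1 + 1 / real p))
      \<le> 7 * C_const p powr (1 / real p - 1) * norm (real n powr (1 / real p - real p) * E_fun p (real n))"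
    unfolding lp_norm_gcd_mat T_def[symmetric] r_def[symmetric] by (simp add: M_powr e1)
qed

end
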